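(* Let $N, S \geq 1$ be integers, and let $y_i, x_i, z_i$ ($i=1,\ldots,N$) and $f_{is}$ ($i=1,\ldots,N$, $s=1,\ldots,S$) be real numbers, with $\sum_{i=1}^N y_i = \sum_{i=1}^N x_i = 0$. Let $\Delta^S = \{p \in \mathbb{R}^S : p_s \geq 0 \text{ for all } s,\ \sum_{s=1}^S p_s = 1\}$. For $p \in \Delta^S$ put $\mu_i(p) = \sum_{s=1}^S f_{is} p_s$, $\tilde z_i(p) = z_i - \mu_i(p)$, $D(p) = \sum_{i=1}^N x_i \tilde z_i(p)$ and, when $D(p) \neq 0$, $$\hat\beta(p) = \frac{\sum_{i=1}^N y_i \tilde z_i(p)}{\sum_{i=1}^N x_i \tilde z_i(p)}.$$ Suppose that $\mathcal{P} \subseteq \Delta^S$ is a polyhedron, written as $\mathcal{P} = \{p \in \Delta^S : Ap \leq c\}$ for some known real matrix $A$ and vector $c$. Let $\mathcal{P}_{D\neq 0} = \{p \in \mathcal{P} : D(p) \neq 0\}$ and $$\underline\beta(\mathcal{P}) = \inf_{p \in \mathcal{P}_{D \neq 0}} \hat\beta(p), \qquad \overline\beta(\mathcal{P}) = \sup_{p \in \mathcal{P}_{D \neq 0}} \hat\beta(p).$$ (1) If $D(p) \geq 0$ for all $p \in \mathcal{P}$, then $$\underline\beta(\mathcal{P}) = \min_{\phi \in \mathbb{R}^S,\ \tau \in \mathbb{R}} \ \sum_{i=1}^N y_i z_i \tau - \sum_{i=1}^N \sum_{s=1}^S y_i f_{is} \phi_s$$ subject to $$\tau \geq 0,\quad \phi_s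 \geq 0 \text{ for all } s=1,\ldots,S,\quad \sum_{s=1}^S \phi_s = \tau,\quad A\phi \leq c\tau,\quad \sum_{i=1}^N x_i z_i \tau - \sum_{i=1}^N \sum_{s=1}^S x_i f_{is}\phi_s = 1,$$ and $\overline\beta(\mathcal{P})$ is the optimal value of the corresponding maximization problem (same objective and constraints). Moreover, for any real number $b \in [\underline\beta(\mathcal{P}), \overline\beta(\mathcal{P})]$ there exists $p \in \mathcal{P}$ (with $D(p)\neq 0$, so that $\hat\beta(p)$ is defined) such that $\hat\beta(p) = b$. (2) If instead $D(p) \leq 0$ for all $p \in \mathcal{P}$, then, with the last constraint changed to $\sum_{i=1}^N x_i z_i \tau - \sum_{i=1}^N \sum_{s=1}^S x_i f_{is}\phi_s = -1$ and all other constraints and the objective unchanged, $-\overline\beta(\mathcal{P})$ is the optimal value of the minimization problem and $-\underline\beta(\mathcal{P})$ is the optimal value of the corresponding maximization problem. Moreover, for any real number $b \in [\underline\beta(\mathcal{P}), \overline\beta(\mathcal{P})]$ there exists $p \in \mathcal{P}$ (with $D(p) \neq 0$) such that $\hat\beta(p) = b$. (3) If $D(p)$ takes both (strictly) positive and (strictly) negative values as $p$ ranges over $\mathcal{P}$, and if it is not the case that $\hat\beta(p)$ is constant for all $p \in \mathcal{P}_{D\neq 0}$, then $\underline\beta(\mathcal{P}) = -\infty$ and $\overline\beta(\mathcal{P}) = +\infty$.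
   Context: Vector inequalities are componentwise. Infima, suprema and optimal values are taken in the extended reals $[-\infty, +\infty]$. The min (max) of a linear program denotes its optimal value: it is $-\infty$ for an unbounded minimization problem and $+\infty$ for an unbounded maximization problem. Infima over the empty set (and values of infeasible minimization problems) are $+\infty$; suprema over the empty set (and values of infeasible maximization problems) are $-\infty$. Origin of the quantities: $y_i$ is an outcome, $x_i$ a treatment, and $z_i = f_i(g;w)$ an instrument given by a known function $f_i$ of a shock vector $g$ and covariates $w$. The numbers $f_{is} = f_i((g_{1s},\ldots,g_{Ks}); w)$ are the values of the instrument formula at $S$ possible shock realizations $(g_{1s},\ldots,g_{Ks})$, which have probabilities $p_s$. For the statement, only the real numbers $y_i, x_i, z_i, f_{is}$ matter. The quantity $\hat\beta(p)$ is the recentered instrumental variable estimator. *)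

theory Defs
  imports "HOL-Analysis.Analysis"
begin

definition prob_simplex :: "(real ^ 's::finite) set" where
  "prob_simplex = {p. (\<forall>s. 0 \<le> p $ s) \<and> (\<Sum>s\<in>UNIV. p $ s) = 1}"

definition expected_instr :: "real ^ 's::finite ^ 'n::finite \<Rightarrow> real ^ 's \<Rightarrow> 'n \<Rightarrow> real" where
  "expected_instr f p i = (\<Sum>s\<in>UNIV. f $ i $ s * p $ s)"

definition recentered_instr ::
    "real ^ 'n::finite \<Rightarrow> real ^ 's::finite ^ 'n \<Rightarrow> real ^ 's \<Rightarrow> 'n \<Rightarrow> real" where
  "recentered_instr z f p i = z $ i - expected_instr f p i"

definition denom ::
    "real ^ 'n::finite \<Rightarrow> real ^ 'n \<Rightarrow> real ^ 's::finite ^ 'n \<Rightarrow> real ^ 's \<Rightarrow> real" where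
  "denom x z f p = (\<Sum>i\<in>UNIV. x $ i * recentered_instr z f p i)"

(* Only meaningful when denom x z f p is nonzero; every use below is restricted to such p. *)
definition beta_hat ::
    "real ^ 'n::finite \<Rightarrow> real ^ 'n \<Rightarrow> real ^ 'n \<Rightarrow> real ^ 's::finite ^ 'n \<Rightarrow> real ^ 's \<Rightarrow> real" where
  "beta_hat y x z f p =
     (\<Sum>i\<in>UNIV. y $ i * recentered_instr z f p i) / denom x z f p"

definition nonzero_denom ::
    "real ^ 'n::finite \<Rightarrow> real ^ 'n \<Rightarrow> real ^ 's::finite ^ 'n \<Rightarrow> (real ^ 's) set \<Rightarrow> (real ^ 's) set" where
  "nonzero_denom x z f P = {p \<in> P. denom x z f p \<noteq> 0}"

(* In ereal, the infimum (supremum) over the empty set is +\<infinity> (-\<infinity>). *)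
definition beta_lower ::
    "real ^ 'n::finite \<Rightarrow> real ^ 'n \<Rightarrow> real ^ 'n \<Rightarrow> real ^ 's::finite ^ 'n \<Rightarrow> (real ^ 's) set \<Rightarrow> ereal" where
  "beta_lower y x z f P = (INF p\<in>nonzero_denom x z f P. ereal (beta_hat y x z f p))"

definition beta_upper ::
    "real ^ 'n::finite \<Rightarrow> real ^ 'n \<Rightarrow> real ^ 'n \<Rightarrow> real ^ 's::finite ^ 'n \<Rightarrow> (real ^ 's) set \<Rightarrow> ereal" where
  "beta_upper y x z f P = (SUP p\<in>nonzero_denom x z f P. ereal (beta_hat y x z f p))"

definition lp_objective ::
    "real ^ 'n::finite \<Rightarrow> real ^ 'n \<Rightarrow> real ^ 's::finite ^ 'n \<Rightarrow> real ^ 's \<Rightarrow> real \<Rightarrow> real" where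
  "lp_objective y z f \<phi> \<tau> =
     (\<Sum>i\<in>UNIV. y $ i * z $ i * \<tau>) - (\<Sum>i\<in>UNIV. \<Sum>s\<in>UNIV. y $ i * f $ i $ s * \<phi> $ s)"

(* r is the right-hand side of the normalization constraint (1 or -1).
   The order on real ^ 'm is componentwise. *)
definition lp_feasible ::
    "real ^ 'n::finite \<Rightarrow> real ^ 'n \<Rightarrow> real ^ 's::finite ^ 'n \<Rightarrow> real ^ 's ^ 'm::finite \<Rightarrow> real ^ 'm
     \<Rightarrow> real \<Rightarrow> ((real ^ 's) \<times> real) set" where
  "lp_feasible x z f A c r =
     {(\<phi>, \<tau>). 0 \<le> \<tau> \<and> (\<forall>s. 0 \<le> \<phi> $ s) \<and> (\<Sum>s\<in>UNIV. \<phi> $ s) = \<tau> \<and> A *v \<phi> \<le> \<tau> *\<^sub>R c \<and>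
        (\<Sum>i\<in>UNIV. x $ i * z $ i * \<tau>) - (\<Sum>i\<in>UNIV. \<Sum>s\<in>UNIV. x $ i * f $ i $ s * \<phi> $ s) = r}"

(* Optimal values in ereal: unbounded and infeasible programs get the conventional
   infinite values. *)
definition lp_min ::
    "real ^ 'n::finite \<Rightarrow> real ^ 'n \<Rightarrow> real ^ 'n \<Rightarrow> real ^ 's::finite ^ 'n \<Rightarrow> real ^ 's ^ 'm::finite
     \<Rightarrow> real ^ 'm \<Rightarrow> real \<Rightarrow> ereal" where
  "lp_min y x z f A c r = (INF (\<phi>, \<tau>)\<in>lp_feasible x z f A c r. ereal (lp_objective y z f \<phi> \<tau>))"

definition lp_max ::
    "real ^ 'n::finite \<Rightarrow> real ^ 'n \<Rightarrow> real ^ 'n \<Rightarrow> real ^ 's::finite ^ 'n \<Rightarrow> real ^ 's ^ 'm::finite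
     \<Rightarrow> real ^ 'm \<Rightarrow> real \<Rightarrow> ereal" where
  "lp_max y x z f A c r = (SUP (\<phi>, \<tau>)\<in>lp_feasible x z f A c r. ereal (lp_objective y z f \<phi> \<tau>))"

end

theory Submission imports Defs begin

text \<open>
  Numerator and denominator of the estimator are affine functions \<open>n\<close> and \<open>d\<close> of \<open>p\<close>, and
  \<open>(\<phi>, \<tau>) \<mapsto> \<phi> / \<tau>\<close> (with inverse \<open>p \<mapsto> (p, 1) / \<bar>d p\<bar>\<close>) turns the linear program into the
  fractional one.  If \<open>d \<ge> 0\<close> and \<open>n / d\<close> has a finite infimum \<open>b\<close>, then \<open>n - b d \<ge> 0\<close> at all vertices
  of the polytope; were it positive at every vertex with \<open>d > 0\<close>, then \<open>b\<close> could be increased.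
  Hence the infimum is attained at a vertex, and intermediate values follow by convexity.  If \<open>d\<close>
  changes sign and \<open>n / d\<close> is bounded below by \<open>M\<close>, then \<open>n - M d\<close> has the same sign as \<open>d\<close> along every
  segment joining \<open>d > 0\<close> to \<open>d < 0\<close>, so both vanish at the same point of it, and \<open>n / d\<close> takes the
  same value at both ends.
\<close>

section \<open>Ratios of affine functions\<close>

definition affine_fun :: "('a::real_vector \<Rightarrow> real) \<Rightarrow> bool" where
  "affine_fun h \<longleftrightarrow>
     (\<forall>p q u v. u + v = 1 \<longrightarrow> h (u *\<^sub>R p + v *\<^sub>R q) = u * h p + v * h q)"

lemma affine_funD:
  "affine_fun h \<Longrightarrow> u + v = 1 \<Longrightarrow> h (u *\<^sub>R p + v *\<^sub>R q) = u * h p + v * h q"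
  by (simp add: affine_fun_def)

lemma affine_fun_uminus: "affine_fun h \<Longrightarrow> affine_fun (\<lambda>p. - h p)"
  by (simp add: affine_fun_def)

lemma affine_fun_diff_mult:
  assumes "affine_fun n" "affine_fun d"
  shows "affine_fun (\<lambda>p. n p - b * d p)"
  using assms by (simp add: affine_fun_def algebra_simps)

lemma convex_affine_fun_nonneg:
  assumes "affine_fun h"
  shows "convex {p. 0 \<le> h p}"
  using assms by (auto simp: convex_def affine_funD)

text \<open>Points of the segment from \<open>v\<close> towards \<open>p0\<close> have
  \<open>d > 0\<close>, so \<open>h\<close> is nonnegative on them, and \<open>v\<close> is their
  limit. The limit is replaced by one explicit point near \<open>v\<close>.\<close>

lemma affine_fun_nonneg_closure:
  assumes K: "convex K" and h: "affine_fun h" and d: "affine_fun d"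
    and pos: "\<And>p. p \<in> K \<Longrightarrow> 0 < d p \<Longrightarrow> 0 \<le> h p"
    and p0: "p0 \<in> K" "0 < d p0" and v: "v \<in> K" "0 \<le> d v"
  shows "0 \<le> h v"
proof (rule ccontr)
  assume neg: "\<not> 0 \<le> h v"
  define D where "D = h p0 - h v + 1"
  have hp0: "0 \<le> h p0"
    using pos p0 by blast
  have D: "0 < D"
    using hp0 neg by (simp add: D_def)
  \<comment> \<open>Small enough that \<open>h\<close> is still negative at \<open>q\<close>: from
    \<open>t * D = - h v / 2\<close> follows \<open>h q = h v / 2 - t\<close>.\<close>
  define t where "t = - h v / (2 * D)"
  have t: "0 < t" "t < 1"
    using neg hp0 D by (auto simp: t_def D_def field_simps)
  define q where "q = t *\<^sub>R p0 + (1 - t) *\<^sub>R v"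
  have "q \<in> K"
    unfolding q_def using K p0 v t by (intro convexD) auto
  moreover have "d q = t * d p0 + (1 - t) * d v"
    unfolding q_def by (rule affine_funD[OF d]) simp
  then have "0 < d q"
    using t p0 v by (simp add: add_pos_nonneg)
  ultimately have "0 \<le> h q"
    using pos by blast
  moreover have "h q = t * h p0 + (1 - t) * h v"
    unfolding q_def by (rule affine_funD[OF h]) simp
  then have "h q = t * D - t + h v"
    by (simp add: D_def algebra_simps)
  moreover have "t * D = - h v / 2"
    using D by (simp add: t_def)
  ultimately show False
    using t neg by linarith
qed

text \<open>The set where \<open>d\<close> is nonzero need not be compact, so attainment rests on
  the finiteness of a vertex set: strict inequalities at finitely many vertices leave a uniform
  gap.\<close>

lemma ratio_Inf_attained:
  assumes K: "polytope K" and n: "affine_fun n" and d: "affine_fun d"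
    and d_nonneg: "\<And>p. p \<in> K \<Longrightarrow> 0 \<le> d p"
    and inf: "(INF p\<in>{p\<in>K. d p \<noteq> 0}. ereal (n p / d p)) = ereal b"
  shows "\<exists>p\<in>K. d p \<noteq> 0 \<and> n p / d p = b"
proof (rule ccontr)
  assume none: "\<not> ?thesis"
  have "{p\<in>K. d p \<noteq> 0} \<noteq> {}"
  proof
    assume empty: "{p\<in>K. d p \<noteq> 0} = {}"
    show False
      using inf unfolding empty by (simp add: top_ereal_def)
  qed
  then obtain p0 where "p0 \<in> K" "d p0 \<noteq> 0"
    by blast
  with d_nonneg[of p0] have p0: "p0 \<in> K" "0 < d p0"
    by simp_all
  define h where "h = (\<lambda>p. n p - b * d p)"
  have h: "affine_fun h"
    unfolding h_def using n d by (rule affine_fun_diff_mult)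
  have h_nonneg: "0 \<le> h p" if "p \<in> K" "0 < d p" for p
  proof -
    have "ereal b \<le> ereal (n p / d p)"
      unfolding inf[symmetric] by (rule INF_lower) (use that in auto)
    then show ?thesis
      using that by (simp add: h_def field_simps)
  qed
  obtain V where V: "finite V" "K = convex hull V"
    using K by (auto simp: polytope_def)
  have VK: "V \<subseteq> K"
    unfolding V(2) by (rule hull_subset)
  have h_V: "0 \<le> h v" if "v \<in> V" for v
  proof -
    have "v \<in> K"
      using that VK by blast
    then show ?thesis
      using affine_fun_nonneg_closure[OF polytope_imp_convex[OF K] h d h_nonneg p0] d_nonneg by simp
  qed
  define W where "W = {v\<in>V. 0 < d v}"
  have W: "finite W"
    using V by (simp add: W_def)
  have h_W: "0 < h v / d v" if "v \<in> W" for v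
  proof -
    have v: "v \<in> K" "v \<in> V" "0 < d v"
      using that VK by (auto simp: W_def)
    then have "n v / d v \<noteq> b"
      using none by auto
    then have "h v \<noteq> 0"
      using v by (auto simp: h_def)
    then show ?thesis
      using v h_V[of v] by simp
  qed
  \<comment> \<open>The gap by which the ratio exceeds \<open>b\<close> at the vertices in
    \<open>W\<close>. The inserted \<open>1\<close> makes the minimum well defined without an
    argument that \<open>W\<close> is nonempty.\<close>
  define e where "e = Min (insert 1 ((\<lambda>v. h v / d v) ` W))"
  have e: "0 < e" "\<And>v. v \<in> W \<Longrightarrow> e \<le> h v / d v"
    unfolding e_def using W h_W by auto
  \<comment> \<open>The right-hand side is convex, so the bound passes from the vertices to their
    hull. Dividing by \<open>d\<close> then raises the lower bound from \<open>b\<close> to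
    \<open>b + e\<close>.\<close>
  have "V \<subseteq> {p. 0 \<le> h p - e * d p}"
  proof
    fix v assume v: "v \<in> V"
    have "0 \<le> h v - e * d v"
    proof (cases "d v = 0")
      case True
      then show ?thesis
        using h_V[OF v] by simp
    next
      case False
      then have "0 < d v"
        using d_nonneg[of v] v VK by auto
      then show ?thesis
        using e(2)[of v] v by (simp add: W_def field_simps)
    qed
    then show "v \<in> {p. 0 \<le> h p - e * d p}"
      by simp
  qed
  then have ge: "K \<subseteq> {p. 0 \<le> h p - e * d p}"
    unfolding V(2)
    by (intro hull_minimal convex_affine_fun_nonneg affine_fun_diff_mult h d)
  have "ereal (b + e) \<le> (INF p\<in>{p\<in>K. d p \<noteq> 0}. ereal (n p / d p))"
  proof (rule INF_greatest)
    fix p assume "p \<in> {p\<in>K. d p \<noteq> 0}"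
    then have "0 \<le> h p - e * d p" "0 < d p"
      using ge d_nonneg[of p] by auto
    then show "ereal (b + e) \<le> ereal (n p / d p)"
      by (simp add: h_def field_simps)
  qed
  then show False
    unfolding inf using e by simp
qed

lemma ereal_SUP_eq_uminus_INF:
  fixes g :: "'a \<Rightarrow> real"
  shows "(SUP p\<in>I. ereal (g p)) = - (INF p\<in>I. ereal (- g p))"
  using ereal_SUP_uminus_eq[of "\<lambda>p. ereal (- g p)" I] by simp

text \<open>The two extreme values are attained, the supremum after negating \<open>n\<close>. For a
  value strictly between, \<open>n - b * d\<close> changes sign along a segment on which
  \<open>d\<close> stays positive.\<close>

lemma ratio_intermediate_value:
  assumes K: "polytope K" and n: "affine_fun n" and d: "affine_fun d"
    and d_nonneg: "\<And>p. p \<in> K \<Longrightarrow> 0 \<le> d p"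
    and lower: "(INF p\<in>{p\<in>K. d p \<noteq> 0}. ereal (n p / d p)) \<le> ereal b"
    and upper: "ereal b \<le> (SUP p\<in>{p\<in>K. d p \<noteq> 0}. ereal (n p / d p))"
  shows "\<exists>p\<in>K. d p \<noteq> 0 \<and> n p / d p = b"
proof -
  consider "(INF p\<in>{p\<in>K. d p \<noteq> 0}. ereal (n p / d p)) = ereal b"
    | "(SUP p\<in>{p\<in>K. d p \<noteq> 0}. ereal (n p / d p)) = ereal b"
    | "(INF p\<in>{p\<in>K. d p \<noteq> 0}. ereal (n p / d p)) < ereal b"
      "ereal b < (SUP p\<in>{p\<in>K. d p \<noteq> 0}. ereal (n p / d p))"
    using lower upper by fastforce
  then show ?thesis
  proof cases
    case 1
    then show ?thesis
      using ratio_Inf_attained[OF K n d d_nonneg] by blast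
  next
    case 2
    then have "(INF p\<in>{p\<in>K. d p \<noteq> 0}. ereal (- n p / d p)) = ereal (- b)"
      unfolding ereal_SUP_eq_uminus_INF by (simp add: ereal_uminus_eq_reorder)
    from ratio_Inf_attained[OF K affine_fun_uminus[OF n] d d_nonneg this] show ?thesis
      by auto
  next
    case 3
    then obtain p q where pq: "p \<in> K" "d p \<noteq> 0" "n p / d p < b" "q \<in> K" "d q \<noteq> 0" "b < n q / d q"
      by (auto simp: INF_less_iff less_SUP_iff)
    have dpq: "0 < d p" "0 < d q"
      using pq d_nonneg by (force simp: less_le)+
    define h where "h = (\<lambda>p. n p - b * d p)"
    have h: "affine_fun h"
      unfolding h_def using n d by (rule affine_fun_diff_mult)
    have hpq: "h p < 0" "0 < h q"
      using pq dpq by (auto simp: h_def field_simps)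
    \<comment> \<open>Weights for which the combination of \<open>h p\<close> and \<open>h q\<close>
      vanishes.\<close>
    define u where "u = h q / (h q - h p)"
    define v where "v = - h p / (h q - h p)"
    have "u + v = (h q - h p) / (h q - h p)"
      using add_divide_distrib[of "h q" "- h p" "h q - h p"] by (simp add: u_def v_def)
    then have uv: "u + v = 1" "0 < u" "0 < v"
      using hpq by (auto simp: u_def v_def divide_neg_pos)
    define r where "r = u *\<^sub>R p + v *\<^sub>R q"
    have "r \<in> K"
      unfolding r_def using polytope_imp_convex[OF K] pq uv by (intro convexD) auto
    moreover have "0 < d r"
      unfolding r_def using uv dpq by (simp add: affine_funD[OF d] add_pos_pos)
    moreover have "h r = 0"
      unfolding r_def affine_funD[OF h uv(1)] by (simp add: u_def v_def)
    ultimately show ?thesis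
      by (intro bexI[of _ r]) (auto simp: h_def)
  qed
qed

lemma ratio_eq_of_opposite_signs:
  assumes K: "convex K" and n: "affine_fun n" and d: "affine_fun d"
    and ge: "\<And>p. p \<in> K \<Longrightarrow> d p \<noteq> 0 \<Longrightarrow> M \<le> n p / d p"
    and p: "p \<in> K" "0 < d p" and q: "q \<in> K" "d q < 0"
  shows "n p / d p = n q / d q"
proof -
  define h where "h = (\<lambda>p. n p - M * d p)"
  have h: "affine_fun h"
    unfolding h_def using n d by (rule affine_fun_diff_mult)
  have hp: "0 \<le> h p" and hq: "h q \<le> 0"
    using ge[of p] ge[of q] p q by (auto simp: h_def field_simps)
  \<comment> \<open>Multiplying the nonnegative \<open>n r / d r - M\<close> by a square covers both
    signs of \<open>d r\<close>.\<close>
  have hd: "0 \<le> h r * d r" if "r \<in> K" for r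
  proof (cases "d r = 0")
    case False
    have "h r * d r = (n r / d r - M) * (d r)\<^sup>2"
      using False by (simp add: h_def power2_eq_square field_simps)
    then show ?thesis
      using ge[OF that False] by simp
  qed simp
  \<comment> \<open>weights for which the product of the two values is minus the square of their determinant\<close>
  define \<alpha> where "\<alpha> = - (h q + d q)"
  define \<beta> where "\<beta> = h p + d p"
  \<comment> \<open>The \<open>d\<close> terms keep both weights positive even when
    \<open>h p\<close> or \<open>h q\<close> is zero.\<close>
  have ab: "0 < \<alpha>" "0 < \<beta>"
    using hp hq p q by (auto simp: \<alpha>_def \<beta>_def)
  define s where "s = \<alpha> + \<beta>"
  have s: "0 < s"
    using ab by (simp add: s_def)
  \<comment> \<open>The zero of \<open>h + d\<close> on the segment. There
    \<open>h r = - d r\<close>, so \<open>hd\<close> forces both to vanish.\<close>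
  define r where "r = (\<alpha> / s) *\<^sub>R p + (\<beta> / s) *\<^sub>R q"
  have sum1: "\<alpha> / s + \<beta> / s = 1"
    using s by (simp add: s_def flip: add_divide_distrib)
  have "r \<in> K"
    unfolding r_def using K p q ab s sum1 by (intro convexD) auto
  have comb: "s * g r = \<alpha> * g p + \<beta> * g q" if "affine_fun g" for g
    unfolding r_def affine_funD[OF that sum1] using s by (simp add: field_simps)
  have "0 \<le> s\<^sup>2 * (h r * d r)"
    using hd[OF \<open>r \<in> K\<close>] by simp
  also have "\<dots> = (s * h r) * (s * d r)"
    by (simp add: power2_eq_square)
  also have "\<dots> = - ((h p * d q - h q * d p)\<^sup>2)"
    unfolding comb[OF h] comb[OF d] \<alpha>_def \<beta>_def by algebra
  finally have "h p * d q = h q * d p"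
    by simp
  \<comment> \<open>The terms with \<open>M\<close> cancel.\<close>
  then have "n p * d q = n q * d p"
    by (simp add: h_def algebra_simps)
  then show ?thesis
    using p q by (simp add: field_simps)
qed

text \<open>Under a finite lower bound, every point with \<open>d > 0\<close> shares its ratio with
  \<open>q0\<close> and every point with \<open>d < 0\<close> with \<open>p0\<close>; as
  \<open>p0\<close> and \<open>q0\<close> also agree, the ratio would be constant.\<close>

lemma ratio_INF_eq_MInf:
  assumes K: "convex K" and n: "affine_fun n" and d: "affine_fun d"
    and p0: "p0 \<in> K" "0 < d p0" and q0: "q0 \<in> K" "d q0 < 0"
    and nconst: "\<not> (\<exists>k. \<forall>p\<in>{p\<in>K. d p \<noteq> 0}. n p / d p = k)"
  shows "(INF p\<in>{p\<in>K. d p \<noteq> 0}. ereal (n p / d p)) = -\<infinity>"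
proof (rule ccontr)
  assume "(INF p\<in>{p\<in>K. d p \<noteq> 0}. ereal (n p / d p)) \<noteq> -\<infinity>"
  then obtain M where "ereal M \<le> (INF p\<in>{p\<in>K. d p \<noteq> 0}. ereal (n p / d p))"
    by (metis MInfty_neq_ereal(1) ereal_bot linorder_le_cases)
  then have ge: "M \<le> n p / d p" if "p \<in> K" "d p \<noteq> 0" for p
    using that by (auto simp: le_INF_iff)
  note eq = ratio_eq_of_opposite_signs[OF K n d ge]
  have "n p / d p = n p0 / d p0" if "p \<in> K" "d p \<noteq> 0" for p
    using that eq[OF _ _ _ _ q0] eq[OF _ _ p0] p0
    by (metis eq linorder_neqE_linordered_idom q0)
  then show False
    using nconst by blast
qed

section \<open>The linear program\<close>

lemma lp_objective_scale:
  "lp_objective y z f (t *\<^sub>R p) (t * \<tau>) = t * lp_objective y z f p \<tau>"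
  by (simp add: lp_objective_def sum_distrib_left right_diff_distrib mult_ac)

text \<open>The coefficient vector is arbitrary: \<open>y\<close> gives the numerator of the
  estimator, \<open>x\<close> its denominator.\<close>

lemma denom_eq_lp_objective: "denom y z f p = lp_objective y z f p 1"
  by (simp add: denom_def lp_objective_def recentered_instr_def expected_instr_def
      right_diff_distrib sum_subtractf sum_distrib_left mult_ac)

lemma beta_hat_eq: "beta_hat y x z f p = denom y z f p / denom x z f p"
  by (simp add: beta_hat_def denom_def)

text \<open>\<open>lp_objective\<close> is jointly linear in its last two arguments, and
  \<open>denom\<close> is its slice at \<tau> = 1.\<close>

lemma affine_fun_denom: "affine_fun (denom y z f)"
proof -
  have "lp_objective y z f (u *\<^sub>R p + v *\<^sub>R q) (u + v) =
      u * lp_objective y z f p 1 + v * lp_objective y z f q 1" for u v p q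
    by (simp add: lp_objective_def sum_distrib_left sum.distrib algebra_simps)
  then show ?thesis
    unfolding affine_fun_def denom_eq_lp_objective by metis
qed

text \<open>A finite intersection of half-spaces and a hyperplane, bounded because the simplex lies
  in the unit cube.\<close>

lemma polytope_constrained_simplex:
  fixes A :: "real ^ 's::finite ^ 'm::finite"
  shows "polytope {p \<in> prob_simplex. A *v p \<le> c}"
proof -
  have eq: "{p \<in> prob_simplex. A *v p \<le> c} =
      (\<Inter>s. {p. 0 \<le> axis s 1 \<bullet> p}) \<inter> {p. 1 \<bullet> p = 1} \<inter> (\<Inter>i. {p. A $ i \<bullet> p \<le> c $ i})"
    by (auto simp: prob_simplex_def inner_axis' inner_vec_def[of 1] less_eq_vec_def
        matrix_vector_mul_component)
  have "polyhedron {p \<in> prob_simplex. A *v p \<le> c}"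
    unfolding eq
    by (intro polyhedron_Int polyhedron_Inter polyhedron_hyperplane)
      (auto simp: polyhedron_halfspace_le polyhedron_halfspace_ge)
  moreover have "{p \<in> prob_simplex. A *v p \<le> c} \<subseteq> cbox 0 1"
  proof
    fix p :: "real ^ 's" assume "p \<in> {p \<in> prob_simplex. A *v p \<le> c}"
    then have p: "\<And>s. 0 \<le> p $ s" "(\<Sum>s\<in>UNIV. p $ s) = 1"
      by (auto simp: prob_simplex_def)
    have "p $ s \<le> 1" for s
      using member_le_sum[of s UNIV "\<lambda>s. p $ s"] p by simp
    with p show "p \<in> cbox 0 1"
      by (simp add: mem_box_cart)
  qed
  ultimately show ?thesis
    by (meson bounded_cbox bounded_subset polytope_eq_bounded_polyhedron)
qed

text \<open>The Charnes-Cooper change of variables. Normalization gives \<tau> =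
  \<open>r / denom x z f p\<close>, so the objective becomes \<open>r * beta_hat y x z f p\<close>;
  the sign \<open>r\<close> treats both cases at once.\<close>

lemma lp_objective_image:
  assumes P: "P = {p \<in> prob_simplex. A *v p \<le> c}"
    and sign: "r = 1 \<or> r = - 1" "\<And>p. p \<in> P \<Longrightarrow> 0 \<le> r * denom x z f p"
  shows "(\<lambda>(\<phi>, \<tau>). lp_objective y z f \<phi> \<tau>) ` lp_feasible x z f A c r =
    (\<lambda>p. r * beta_hat y x z f p) ` nonzero_denom x z f P" (is "?L = ?R")
proof (intro equalityI subsetI)
  fix a assume "a \<in> ?L"
  then obtain \<phi> \<tau> where a: "a = lp_objective y z f \<phi> \<tau>"
    and \<tau>: "0 \<le> \<tau>" and \<phi>: "\<And>s. 0 \<le> \<phi> $ s" "(\<Sum>s\<in>UNIV. \<phi> $ s) = \<tau>"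
    and A: "A *v \<phi> \<le> \<tau> *\<^sub>R c" and r: "lp_objective x z f \<phi> \<tau> = r"
    by (auto simp: lp_feasible_def lp_objective_def)
  \<comment> \<open>Otherwise \<phi> = 0 as well, and the normalization constraint would read
    \<open>0 = r\<close>.\<close>
  have "\<tau> \<noteq> 0"
  proof
    assume "\<tau> = 0"
    then have "\<phi> = 0"
      using \<phi> by (simp add: sum_nonneg_eq_0_iff vec_eq_iff)
    then show False
      using \<open>\<tau> = 0\<close> r sign(1) by (auto simp: lp_objective_def)
  qed
  with \<tau> have pos: "0 < \<tau>"
    by simp
  define p where "p = (1 / \<tau>) *\<^sub>R \<phi>"
  have \<phi>p: "\<phi> = \<tau> *\<^sub>R p"
    using pos by (simp add: p_def)
  have scale: "lp_objective w z f \<phi> \<tau> = \<tau> * denom w z f p" for w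
    using lp_objective_scale[of w z f \<tau> p 1] by (simp add: \<phi>p denom_eq_lp_objective)
  have "p \<in> P"
    using \<phi> A pos
    by (auto simp: P prob_simplex_def p_def matrix_vector_mult_scaleR less_eq_vec_def field_simps
        simp flip: sum_divide_distrib)
  moreover have "denom x z f p \<noteq> 0"
    using r scale[of x] sign(1) by auto
  moreover have "a = r * beta_hat y x z f p"
    using r \<open>denom x z f p \<noteq> 0\<close> by (simp add: a scale beta_hat_eq flip: r)
  ultimately show "a \<in> ?R"
    by (auto simp: nonzero_denom_def)
next
  fix a assume "a \<in> ?R"
  then obtain p where p: "p \<in> P" "denom x z f p \<noteq> 0" and a: "a = r * beta_hat y x z f p"
    by (auto simp: nonzero_denom_def)
  define \<tau> where "\<tau> = r / denom x z f p"
  have "0 < r * denom x z f p"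
    using sign p by (auto simp: less_le)
  then have pos: "0 < \<tau>"
    by (auto simp: \<tau>_def zero_less_mult_iff zero_less_divide_iff)
  have scale: "lp_objective w z f (\<tau> *\<^sub>R p) \<tau> = \<tau> * denom w z f p" for w
    using lp_objective_scale[of w z f \<tau> p 1] by (simp add: denom_eq_lp_objective)
  have "lp_objective x z f (\<tau> *\<^sub>R p) \<tau> = r"
    unfolding scale using p by (simp add: \<tau>_def)
  then have "(\<tau> *\<^sub>R p, \<tau>) \<in> lp_feasible x z f A c r"
    using p(1) pos
    by (auto simp: lp_feasible_def lp_objective_def P prob_simplex_def matrix_vector_mult_scaleR
        less_eq_vec_def simp flip: sum_distrib_left)
  moreover have "a = lp_objective y z f (\<tau> *\<^sub>R p) \<tau>"
    unfolding a scale beta_hat_eq by (simp add: \<tau>_def)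
  ultimately show "a \<in> ?L"
    by force
qed

text \<open>Equal sets of values have equal infima and suprema, so infeasible and unbounded programs
  need no separate treatment.\<close>

lemma lp_values:
  assumes "P = {p \<in> prob_simplex. A *v p \<le> c}"
    and "r = 1 \<or> r = - 1" "\<And>p. p \<in> P \<Longrightarrow> 0 \<le> r * denom x z f p"
  shows "lp_min y x z f A c r = (INF p\<in>nonzero_denom x z f P. ereal (r * beta_hat y x z f p))"
    and "lp_max y x z f A c r = (SUP p\<in>nonzero_denom x z f P. ereal (r * beta_hat y x z f p))"
proof -
  have eq: "(\<lambda>(\<phi>, \<tau>). ereal (lp_objective y z f \<phi> \<tau>)) ` lp_feasible x z f A c r =
      (\<lambda>p. ereal (r * beta_hat y x z f p)) ` nonzero_denom x z f P"
    using arg_cong[OF lp_objective_image[OF assms, of y], of "image ereal"]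
    by (simp add: image_image case_prod_unfold)
  show "lp_min y x z f A c r = (INF p\<in>nonzero_denom x z f P. ereal (r * beta_hat y x z f p))"
    unfolding lp_min_def eq ..
  show "lp_max y x z f A c r = (SUP p\<in>nonzero_denom x z f P. ereal (r * beta_hat y x z f p))"
    unfolding lp_max_def eq ..
qed

theorem proposition1:
  fixes y x z :: "real ^ 'n::finite"
    and f :: "real ^ 's::finite ^ 'n"
    and A :: "real ^ 's ^ 'm::finite"
    and c :: "real ^ 'm"
    and P :: "(real ^ 's) set"
  assumes sum_y: "(\<Sum>i\<in>UNIV. y $ i) = 0"
    and sum_x: "(\<Sum>i\<in>UNIV. x $ i) = 0"
    and P_eq: "P = {p \<in> prob_simplex. A *v p \<le> c}"
  shows
    "((\<forall>p\<in>P. denom x z f p \<ge> 0) \<longrightarrow>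
        beta_lower y x z f P = lp_min y x z f A c 1 \<and>
        beta_upper y x z f P = lp_max y x z f A c 1 \<and>
        (\<forall>b::real. beta_lower y x z f P \<le> ereal b \<and> ereal b \<le> beta_upper y x z f P \<longrightarrow>
           (\<exists>p\<in>P. denom x z f p \<noteq> 0 \<and> beta_hat y x z f p = b))) \<and>
     ((\<forall>p\<in>P. denom x z f p \<le> 0) \<longrightarrow>
        - beta_upper y x z f P = lp_min y x z f A c (- 1) \<and>
        - beta_lower y x z f P = lp_max y x z f A c (- 1) \<and>
        (\<forall>b::real. beta_lower y x z f P \<le> ereal b \<and> ereal b \<le> beta_upper y x z f P \<longrightarrow>
           (\<exists>p\<in>P. denom x z f p \<noteq> 0 \<and> beta_hat y x z f p = b))) \<and>
     ((\<exists>p\<in>P. denom x z f p > 0) \<and> (\<exists>p\<in>P. denom x z f p < 0) \<and>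
        \<not> (\<exists>k. \<forall>p\<in>nonzero_denom x z f P. beta_hat y x z f p = k) \<longrightarrow>
        beta_lower y x z f P = -\<infinity> \<and> beta_upper y x z f P = \<infinity>)"
proof -
  have K: "polytope P"
    unfolding P_eq by (rule polytope_constrained_simplex)
  let ?n = "denom y z f" and ?d = "denom x z f"
  let ?n' = "\<lambda>p. - ?n p" and ?d' = "\<lambda>p. - ?d p"
  note n = affine_fun_denom[of y z f] and d = affine_fun_denom[of x z f]
  note n' = affine_fun_uminus[OF n] and d' = affine_fun_uminus[OF d]
  note defs = beta_lower_def beta_upper_def nonzero_denom_def beta_hat_eq
  show ?thesis
  proof (intro conjI impI allI; (elim conjE)?)
    assume "\<forall>p\<in>P. ?d p \<ge> 0"
    then have nn: "\<And>p. p \<in> P \<Longrightarrow> 0 \<le> 1 * ?d p"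
      by simp
    note lp = lp_values[OF P_eq _ nn, where y = y]
    show "beta_lower y x z f P = lp_min y x z f A c 1"
      using lp(1) by (simp add: beta_lower_def)
    show "beta_upper y x z f P = lp_max y x z f A c 1"
      using lp(2) by (simp add: beta_upper_def)
  next
    fix b
    assume "\<forall>p\<in>P. ?d p \<ge> 0" and b: "beta_lower y x z f P \<le> ereal b" "ereal b \<le> beta_upper y x z f P"
    then have nn: "\<And>p. p \<in> P \<Longrightarrow> 0 \<le> ?d p"
      by simp
    show "\<exists>p\<in>P. ?d p \<noteq> 0 \<and> beta_hat y x z f p = b"
      using ratio_intermediate_value[OF K n d nn b[unfolded defs]] unfolding beta_hat_eq .
  next
    assume "\<forall>p\<in>P. ?d p \<le> 0"
    then have nn: "\<And>p. p \<in> P \<Longrightarrow> 0 \<le> - 1 * ?d p"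
      by simp
    \<comment> \<open>For \<open>r = - 1\<close> the program takes the values
      \<open>- beta_hat\<close>, and negation exchanges infimum and supremum.\<close>
    note lp = lp_values[OF P_eq _ nn, where y = y]
    show "- beta_upper y x z f P = lp_min y x z f A c (- 1)"
      using lp(1) ereal_INF_uminus_eq[of "\<lambda>p. ereal (beta_hat y x z f p)" "nonzero_denom x z f P"]
      by (simp add: beta_upper_def)
    show "- beta_lower y x z f P = lp_max y x z f A c (- 1)"
      using lp(2) ereal_SUP_uminus_eq[of "\<lambda>p. ereal (beta_hat y x z f p)" "nonzero_denom x z f P"]
      by (simp add: beta_lower_def)
  next
    fix b
    assume "\<forall>p\<in>P. ?d p \<le> 0" and b: "beta_lower y x z f P \<le> ereal b" "ereal b \<le> beta_upper y x z f P"
    then have nn: "\<And>p. p \<in> P \<Longrightarrow> 0 \<le> ?d' p"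
      by simp
    \<comment> \<open>Negating numerator and denominator together keeps the ratio and makes the
      denominator nonnegative.\<close>
    show "\<exists>p\<in>P. ?d p \<noteq> 0 \<and> beta_hat y x z f p = b"
      using ratio_intermediate_value[OF K n' d' nn, of b] b
      unfolding defs by simp
  next
    assume signs: "\<exists>p\<in>P. ?d p > 0" "\<exists>p\<in>P. ?d p < 0"
      and nc: "\<not> (\<exists>k. \<forall>p\<in>nonzero_denom x z f P. beta_hat y x z f p = k)"
    obtain p q where pq: "p \<in> P" "?d p > 0" "q \<in> P" "?d q < 0"
      using signs by blast
    show "beta_lower y x z f P = -\<infinity>"
      using ratio_INF_eq_MInf[OF polytope_imp_convex[OF K] n d pq nc[unfolded defs]]
      unfolding defs .
    \<comment> \<open>The supremum is minus the infimum for the negated numerator, whose ratio must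
      also be shown nonconstant.\<close>
    have "\<not> (\<exists>k. \<forall>p\<in>{p\<in>P. ?d p \<noteq> 0}. - ?n p / ?d p = k)"
    proof
      assume "\<exists>k. \<forall>p\<in>{p\<in>P. ?d p \<noteq> 0}. - ?n p / ?d p = k"
      then obtain k where "\<forall>p\<in>{p\<in>P. ?d p \<noteq> 0}. - ?n p / ?d p = k" ..
      then have "\<forall>p\<in>{p\<in>P. ?d p \<noteq> 0}. ?n p / ?d p = - k"
        by force
      with nc[unfolded defs] show False
        by blast
    qed
    from ratio_INF_eq_MInf[OF polytope_imp_convex[OF K] n' d pq this]
    show "beta_upper y x z f P = \<infinity>"
      unfolding defs ereal_SUP_eq_uminus_INF by simp
  qed
qed

end
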